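(* Let $\mu$ be a computable, continuous measure on $2^\omega$ and let $X$ be $\mu$-Martin-Löf random. Then there is some $c$ such that for every $n$, $\mathrm{KA}(X\upharpoonright g_\mu(n))\ge n-c$, and thus $\mathrm{KA}(X\upharpoonright n)\ge g_\mu^{-1}(n)-c$.
   Context: All measures are Borel probability measures on Cantor space $2^\omega$; for a finite binary string $\sigma$ write $\mu(\sigma)=\mu(\{X:\sigma\prec X\})$. A measure $\mu$ is computable if $\sigma\mapsto\mu(\sigma)$ is a computable real-valued function, and continuous if $\mu(\{X\})=0$ for all $X$. A $\mu$-Martin-Löf test is a uniformly $\Sigma^0_1$ sequence $(\mathcal U_i)_{i\in\omega}$ with $\mu(\mathcal U_i)\le 2^{-i}$; $X$ is $\mu$-Martin-Löf random if $X\notin\bigcap_i\mathcal U_i$ for every such test. For a continuous measure $\mu$, the granularity function $g_\mu:\omega\to\omega$ maps $n$ to the least $\ell$ such that $\mu(\sigma)<2^{-n}$ for every string $\sigma$ of length $\ell$; it is non-decreasing and unbounded, and $g_\mu^{-1}(n)=\min\{k:g_\mu(k)\ge n\}$. A semi-measure is a function $\rho:2^{<\omega}\to[0,1]$ with $\rho(\varepsilon)=1$ ($\varepsilon$ the empty string) and $\rho(\sigma)\ge\rho(\sigma0)+\rho(\sigma1)$ for all $\sigma$; it is left-c.e. if its values are uniformly computably approximable from below. $M$ is a fixed universal left-c.e. semi-measure, i.e. for every left-c.e. semi-measure $\rho$ there is $c$ with $\rho\le c\cdot M$. The a priori complexity is $\mathrm{KA}(\sigma)=-\log M(\sigma)$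 (base 2). $X\upharpoonright n$ is the initial segment of $X$ of length $n$. *)

theory Defs
  imports "HOL-Probability.Probability" "HOL-Library.Nat_Bijection"
begin

section \<open>Partial recursive functions\<close>

datatype recf =
    Zero
  | Succ
  | Proj nat
  | Comp recf "recf list"
  | PrimRec recf recf
  | Mini recf

text \<open>
  Terms carry no arity: applied to an argument list that is too short, a term is undefined.
  \<open>Mini\<close> is unbounded minimisation over the first argument; all values below the result
  have to be defined and nonzero.
\<close>

function (sequential) peval :: "recf \<Rightarrow> nat list \<Rightarrow> nat option" where
  "peval Zero xs = Some 0"
| "peval Succ (x # xs) = Some (Suc x)"
| "peval Succ [] = None"
| "peval (Proj i) xs = (if i < length xs then Some (xs ! i) else None)"
| "peval (Comp f gs) xs =
     Option.bind (those (map (\<lambda>g. peval g xs) gs)) (\<lambda>ys. peval f ys)"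
| "peval (PrimRec f g) [] = None"
| "peval (PrimRec f g) (0 # xs) = peval f xs"
| "peval (PrimRec f g) (Suc n # xs) =
     Option.bind (peval (PrimRec f g) (n # xs)) (\<lambda>r. peval g (n # r # xs))"
| "peval (Mini f) xs =
     (if \<exists>n. peval f (n # xs) = Some 0 \<and> (\<forall>m<n. \<exists>k. peval f (m # xs) = Some (Suc k))
      then Some (LEAST n. peval f (n # xs) = Some 0)
      else None)"
  by pat_completeness auto
termination
  by (relation "measures [size \<circ> fst, hd \<circ> snd]") (auto simp: less_Suc_eq_le intro: trans_le_add1 size_list_estimation')

definition computable :: "nat \<Rightarrow> (nat list \<Rightarrow> nat) \<Rightarrow> bool" where
  "computable k f \<longleftrightarrow> (\<exists>p. \<forall>xs. length xs = k \<longrightarrow> peval p xs = Some (f xs))"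

text \<open>A rational-valued function is computable if numerator and denominator are; the numerator
  is given as a difference and the denominator as a successor.\<close>

definition computable_rat :: "nat \<Rightarrow> (nat list \<Rightarrow> rat) \<Rightarrow> bool" where
  "computable_rat k q \<longleftrightarrow>
     (\<exists>a b d. computable k a \<and> computable k b \<and> computable k d \<and>
       (\<forall>xs. length xs = k \<longrightarrow>
          q xs = (of_nat (a xs) - of_nat (b xs)) / of_nat (Suc (d xs))))"

section \<open>Binary strings and Cantor space\<close>

definition str_code :: "bool list \<Rightarrow> nat" where
  "str_code \<sigma> = list_encode (map of_bool \<sigma>)"

definition computable_real_fun :: "(bool list \<Rightarrow> real) \<Rightarrow> bool" where
  "computable_real_fun h \<longleftrightarrow>
     (\<exists>q. computable_rat 2 q \<and>
       (\<forall>\<sigma> t. \<bar>of_rat (q [str_code \<sigma>, t]) - h \<sigma>\<bar> \<le> (1 / 2) ^ t))"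

definition left_ce :: "(bool list \<Rightarrow> real) \<Rightarrow> bool" where
  "left_ce h \<longleftrightarrow>
     (\<exists>q. computable_rat 2 q \<and>
       (\<forall>\<sigma>. incseq (\<lambda>t. q [str_code \<sigma>, t]) \<and>
            (\<lambda>t. of_rat (q [str_code \<sigma>, t])) \<longlonglongrightarrow> h \<sigma>))"

definition init_seg :: "(nat \<Rightarrow> bool) \<Rightarrow> nat \<Rightarrow> bool list" where
  "init_seg X n = map X [0..<n]"

definition cylinder :: "bool list \<Rightarrow> (nat \<Rightarrow> bool) set" where
  "cylinder \<sigma> = {X. init_seg X (length \<sigma>) = \<sigma>}"

text \<open>The topology on \<^typ>\<open>nat \<Rightarrow> bool\<close> is the product of the discrete topologies,
  so \<^const>\<open>borel\<close> is the Borel \<open>\<sigma>\<close>-algebra of Cantor space.\<close>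

definition cantor_measure :: "(nat \<Rightarrow> bool) measure \<Rightarrow> bool" where
  "cantor_measure \<mu> \<longleftrightarrow> prob_space \<mu> \<and> sets \<mu> = sets borel"

definition computable_measure :: "(nat \<Rightarrow> bool) measure \<Rightarrow> bool" where
  "computable_measure \<mu> \<longleftrightarrow> computable_real_fun (\<lambda>\<sigma>. measure \<mu> (cylinder \<sigma>))"

definition continuous_measure :: "(nat \<Rightarrow> bool) measure \<Rightarrow> bool" where
  "continuous_measure \<mu> \<longleftrightarrow> (\<forall>X. measure \<mu> {X} = 0)"

section \<open>Martin-Loef randomness\<close>

text \<open>The set of pairs \<open>(i, \<sigma>)\<close> on which \<open>p\<close> halts is an arbitrary c.e. set; \<open>U i\<close> is the
  union of the cylinders it lists for \<open>i\<close>.\<close>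

definition uniformly_sigma01 :: "(nat \<Rightarrow> (nat \<Rightarrow> bool) set) \<Rightarrow> bool" where
  "uniformly_sigma01 U \<longleftrightarrow>
     (\<exists>p. \<forall>i. U i = (\<Union>\<sigma>\<in>{\<sigma>. peval p [i, str_code \<sigma>] \<noteq> None}. cylinder \<sigma>))"

definition ml_test :: "(nat \<Rightarrow> bool) measure \<Rightarrow> (nat \<Rightarrow> (nat \<Rightarrow> bool) set) \<Rightarrow> bool" where
  "ml_test \<mu> U \<longleftrightarrow> uniformly_sigma01 U \<and> (\<forall>i. measure \<mu> (U i) \<le> (1 / 2) ^ i)"

definition ml_random :: "(nat \<Rightarrow> bool) measure \<Rightarrow> (nat \<Rightarrow> bool) \<Rightarrow> bool" where
  "ml_random \<mu> X \<longleftrightarrow> (\<forall>U. ml_test \<mu> U \<longrightarrow> X \<notin> (\<Inter>i. U i))"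

section \<open>Granularity\<close>

definition granularity :: "(nat \<Rightarrow> bool) measure \<Rightarrow> nat \<Rightarrow> nat" where
  "granularity \<mu> n =
     (LEAST l. \<forall>\<sigma>. length \<sigma> = l \<longrightarrow> measure \<mu> (cylinder \<sigma>) < (1 / 2) ^ n)"

definition granularity_inv :: "(nat \<Rightarrow> bool) measure \<Rightarrow> nat \<Rightarrow> nat" where
  "granularity_inv \<mu> n = (LEAST k. granularity \<mu> k \<ge> n)"

section \<open>Semi-measures and a priori complexity\<close>

definition semi_measure :: "(bool list \<Rightarrow> real) \<Rightarrow> bool" where
  "semi_measure \<rho> \<longleftrightarrow>
     (\<forall>\<sigma>. 0 \<le> \<rho> \<sigma> \<and> \<rho> \<sigma> \<le> 1) \<and> \<rho> [] = 1 \<and>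
     (\<forall>\<sigma>. \<rho> \<sigma> \<ge> \<rho> (\<sigma> @ [False]) + \<rho> (\<sigma> @ [True]))"

definition universal_left_ce_semi_measure :: "(bool list \<Rightarrow> real) \<Rightarrow> bool" where
  "universal_left_ce_semi_measure M \<longleftrightarrow>
     semi_measure M \<and> left_ce M \<and>
     (\<forall>\<rho>. semi_measure \<rho> \<and> left_ce \<rho> \<longrightarrow> (\<exists>c. \<forall>\<sigma>. \<rho> \<sigma> \<le> c * M \<sigma>))"

text \<open>Universality makes \<open>M\<close> strictly positive (compare it with the semi-measure that is 1 on the
  prefixes of a given string and 0 elsewhere), so the value of the logarithm at 0 is irrelevant.\<close>

definition KA :: "(bool list \<Rightarrow> real) \<Rightarrow> bool list \<Rightarrow> real" where
  "KA M \<sigma> = - log 2 (M \<sigma>)"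

end

theory Submission
  imports Defs "HOL-Library.Sublist"
begin

text \<open>
  The heart of the matter is that \<open>M / \<mu>\<close> is a lower semicomputable supermartingale with respect to
  \<open>\<mu>\<close>, so it stays bounded along a \<open>\<mu>\<close>-random sequence. Let \<open>U i\<close> be the union of the cylinders of
  the strings \<open>\<sigma>\<close> with \<open>M \<sigma> > 2 ^ i * \<mu> \<sigma>\<close>. Approximating \<open>M\<close> from below and \<open>\<mu>\<close> from
  above enumerates these strings (\<open>semi_measure_test_sigma01\<close>), and a maximal inequality of
  Ville's kind bounds the measure of \<open>U i\<close> by \<open>2 ^ (-i)\<close> (\<open>semi_measure_maximal_inequality\<close>).
  Hence the \<open>U i\<close> form a Martin-Loef test, and a random \<open>X\<close> avoids some \<open>U i\<close>, which says that
  \<open>M \<le> 2 ^ i * \<mu>\<close> on all initial segments of \<open>X\<close> (\<open>ml_random_imp_ratio_bounded\<close>).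

  At length \<open>granularity \<mu> n\<close> every cylinder has measure below \<open>2 ^ (-n)\<close>. This is the definition
  once some such length exists, and continuity of \<open>\<mu>\<close> provides one (\<open>granularity_attained\<close>). So
  \<open>M\<close> is at most \<open>2 ^ (i - n)\<close> there, and since \<open>M\<close> is positive (\<open>universal_semi_measure_pos\<close>)
  taking logarithms gives the first bound. The second one is trivial if \<open>granularity_inv \<mu> n\<close> is 0,
  as \<open>M\<close> is at most 1. Otherwise put
  \<open>k = granularity_inv \<mu> n - 1\<close>. Then \<open>granularity \<mu> k < n\<close> by minimality, and \<open>M\<close> decreases
  along \<open>X\<close>, so the first bound at \<open>k\<close> carries over to length \<open>n\<close>. The step from
  \<open>granularity_inv \<mu> n\<close> to its predecessor costs one more unit in the constant.
\<close>

section \<open>Closure properties of computable functions\<close>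

lemma computable_proj: "i < k \<Longrightarrow> computable k (\<lambda>xs. xs ! i)"
  unfolding computable_def by (rule exI[of _ "Proj i"]) auto

lemma computable_compose:
  assumes f: "computable (length gs) f" and gs: "\<And>g. g \<in> set gs \<Longrightarrow> computable k g"
  shows "computable k (\<lambda>xs. f (map (\<lambda>g. g xs) gs))"
proof -
  obtain p where p: "\<And>ys. length ys = length gs \<Longrightarrow> peval p ys = Some (f ys)"
    using f unfolding computable_def by auto
  have "\<exists>r. \<forall>xs. length xs = k \<longrightarrow> peval r xs = Some (g xs)" if "g \<in> set gs" for g
    using gs[OF that] unfolding computable_def .
  then obtain r where r: "\<And>g xs. g \<in> set gs \<Longrightarrow> length xs = k \<Longrightarrow> peval (r g) xs = Some (g xs)"
    by metis
  have those_Some: "those (map (\<lambda>g. Some (g xs)) hs) = Some (map (\<lambda>g. g xs) hs)"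
    for hs :: "(nat list \<Rightarrow> nat) list" and xs
    by (induction hs) auto
  have "peval (Comp p (map r gs)) xs = Some (f (map (\<lambda>g. g xs) gs))" if "length xs = k" for xs
  proof -
    have "map (\<lambda>q. peval q xs) (map r gs) = map (\<lambda>g. Some (g xs)) gs"
      using r that by auto
    then show ?thesis by (simp only: peval.simps those_Some) (simp add: p)
  qed
  then show ?thesis unfolding computable_def by blast
qed

lemma computable_compose1:
  assumes "computable 1 f" "computable k g"
  shows "computable k (\<lambda>xs. f [g xs])"
proof -
  have "computable k (\<lambda>xs. f (map (\<lambda>h. h xs) [g]))"
    by (rule computable_compose) (use assms in auto)
  then show ?thesis by simp
qed

lemma computable_compose2:
  assumes "computable 2 f" "computable k g" "computable k h"
  shows "computable k (\<lambda>xs. f [g xs, h xs])"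
proof -
  have "computable k (\<lambda>xs. f (map (\<lambda>h. h xs) [g, h]))"
    by (rule computable_compose) (use assms in \<open>auto simp: numeral_2_eq_2\<close>)
  then show ?thesis by simp
qed

lemma computable_Suc:
  assumes "computable k f"
  shows "computable k (\<lambda>xs. Suc (f xs))"
proof -
  have "computable 1 (\<lambda>xs. Suc (xs ! 0))"
    unfolding computable_def by (rule exI[of _ Succ]) (auto simp: length_Suc_conv)
  from computable_compose1[OF this assms] show ?thesis by simp
qed

lemma computable_const: "computable k (\<lambda>_. c)"
proof (induction c)
  case 0
  show ?case unfolding computable_def by (rule exI[of _ Zero]) auto
qed (rule computable_Suc)

lemma computable_primrec:
  assumes "computable k f" "computable (Suc (Suc k)) g"
    and "\<And>xs. length xs = k \<Longrightarrow> h (0 # xs) = f xs"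
    and "\<And>n xs. length xs = k \<Longrightarrow> h (Suc n # xs) = g (n # h (n # xs) # xs)"
  shows "computable (Suc k) h"
proof -
  obtain p r where p: "\<And>xs. length xs = k \<Longrightarrow> peval p xs = Some (f xs)"
    and r: "\<And>xs. length xs = Suc (Suc k) \<Longrightarrow> peval r xs = Some (g xs)"
    using assms(1,2) unfolding computable_def by auto
  have "peval (PrimRec p r) (n # xs) = Some (h (n # xs))" if "length xs = k" for n xs
    by (induction n) (use that p r assms(3,4) in auto)
  then show ?thesis
    unfolding computable_def by (intro exI[of _ "PrimRec p r"]) (auto simp: length_Suc_conv)
qed

lemma computable_add:
  assumes "computable k f" "computable k g"
  shows "computable k (\<lambda>xs. f xs + g xs)"
proof -
  have "computable (Suc 1) (\<lambda>xs. xs ! 0 + xs ! 1)"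
    by (rule computable_primrec[where f = "\<lambda>xs. xs ! 0" and g = "\<lambda>xs. Suc (xs ! 1)"])
      (auto intro!: computable_Suc computable_proj)
  from computable_compose2[OF this[unfolded Suc_1] assms] show ?thesis by simp
qed

lemma computable_mult:
  assumes "computable k f" "computable k g"
  shows "computable k (\<lambda>xs. f xs * g xs)"
proof -
  have "computable (Suc 1) (\<lambda>xs. xs ! 0 * xs ! 1)"
    by (rule computable_primrec[where f = "\<lambda>xs. 0" and g = "\<lambda>xs. xs ! 2 + xs ! 1"])
      (auto intro!: computable_add computable_const computable_proj)
  from computable_compose2[OF this[unfolded Suc_1] assms] show ?thesis by simp
qed

lemma computable_power2:
  assumes "computable k f"
  shows "computable k (\<lambda>xs. 2 ^ f xs)"
proof -
  have "computable (Suc 0) (\<lambda>xs. 2 ^ (xs ! 0))"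
    by (rule computable_primrec[where f = "\<lambda>xs. 1" and g = "\<lambda>xs. 2 * xs ! 1"])
      (auto intro!: computable_mult computable_const computable_proj)
  from computable_compose1[OF this[folded One_nat_def] assms] show ?thesis by simp
qed

lemma computable_diff:
  assumes "computable k f" "computable k g"
  shows "computable k (\<lambda>xs. f xs - g xs)"
proof -
  have "computable (Suc 0) (\<lambda>xs. xs ! 0 - 1)"
    by (rule computable_primrec[where f = "\<lambda>xs. 0" and g = "\<lambda>xs. xs ! 0"])
      (auto intro!: computable_const computable_proj)
  from computable_compose1[OF this[folded One_nat_def] computable_proj[of 1 "Suc (Suc 1)"]]
  have pred: "computable (Suc (Suc 1)) (\<lambda>xs. xs ! 1 - 1)" by simp
  \<comment> \<open>Primitive recursion runs on the first argument, hence the subtrahend comes first.\<close>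
  have "computable (Suc 1) (\<lambda>xs. xs ! 1 - xs ! 0)"
    by (rule computable_primrec[where f = "\<lambda>xs. xs ! 0", OF _ pred])
      (auto intro!: computable_proj)
  from computable_compose2[OF this[unfolded Suc_1] assms(2,1)] show ?thesis by simp
qed

lemmas computable_intros =
  computable_proj computable_const computable_Suc computable_add computable_mult
  computable_power2 computable_diff computable_compose2

text \<open>Unbounded minimisation turns an existential quantifier over a decidable relation into a halting
  condition. Because \<open>f\<close> is total, the search never gets stuck before its first zero.\<close>

lemma semidecidable_search:
  assumes "computable (Suc k) f"
  shows "\<exists>p. \<forall>xs. length xs = k \<longrightarrow> (peval p xs \<noteq> None \<longleftrightarrow> (\<exists>t. f (t # xs) = 0))"
proof -
  obtain p where p: "\<And>xs. length xs = Suc k \<Longrightarrow> peval p xs = Some (f xs)"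
    using assms unfolding computable_def by auto
  have "peval (Mini p) xs \<noteq> None \<longleftrightarrow> (\<exists>t. f (t # xs) = 0)" if "length xs = k" for xs
  proof
    assume "\<exists>t. f (t # xs) = 0"
    then have "f ((LEAST t. f (t # xs) = 0) # xs) = 0" by (rule LeastI_ex)
    moreover have "\<exists>j. f (m # xs) = Suc j" if "m < (LEAST t. f (t # xs) = 0)" for m
      using not_less_Least[OF that] not0_implies_Suc by blast
    ultimately have "\<exists>n. peval p (n # xs) = Some 0 \<and> (\<forall>m<n. \<exists>j. peval p (m # xs) = Some (Suc j))"
      using that by (intro exI[of _ "LEAST t. f (t # xs) = 0"]) (simp add: p)
    then show "peval (Mini p) xs \<noteq> None" by simp
  next
    assume "peval (Mini p) xs \<noteq> None"
    then have "\<exists>n. peval p (n # xs) = Some 0" by (auto split: if_splits)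
    then show "\<exists>t. f (t # xs) = 0" using that by (simp add: p)
  qed
  then show ?thesis by blast
qed

text \<open>Needed to exhibit a left-c.e. semi-measure that charges a prescribed string.\<close>

lemma computable_finite_indicator:
  assumes "finite A" "i < k"
  shows "computable k (\<lambda>xs. of_bool (xs ! i \<in> A))"
proof -
  \<comment> \<open>The factor for \<open>a\<close> is the distance of the argument from \<open>a\<close>, written with truncated
    subtraction; so the product vanishes exactly on \<open>A\<close>.\<close>
  have "computable k (\<lambda>xs. \<Prod>a\<in>A. (xs ! i - a) + (a - xs ! i))"
    using assms(1)
    by (induction rule: finite_induct) (auto intro!: computable_intros simp: assms(2))
  then have "computable k (\<lambda>xs. 1 - (\<Prod>a\<in>A. (xs ! i - a) + (a - xs ! i)))"
    by (intro computable_intros)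
  moreover have "1 - (\<Prod>a\<in>A. (x - a) + (a - x)) = of_bool (x \<in> A)" for x :: nat
  proof (cases "x \<in> A")
    case False
    with assms(1) have "(\<Prod>a\<in>A. (x - a) + (a - x)) \<noteq> 0" by induction auto
    with False show ?thesis by simp
  next
    case True
    then have "(\<Prod>a\<in>A. (x - a) + (a - x)) = 0"
      unfolding prod_zero_iff[OF assms(1)] by (intro bexI[of _ x]) auto
    with True show ?thesis by simp
  qed
  ultimately show ?thesis by simp
qed

section \<open>Cylinders and granularity\<close>

lemma length_init_seg [simp]: "length (init_seg X n) = n"
  by (simp add: init_seg_def)

lemma init_seg_Suc: "init_seg X (Suc n) = init_seg X n @ [X n]"
  by (simp add: init_seg_def)

lemma mem_cylinder_init_seg: "X \<in> cylinder (init_seg X n)"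
  by (simp add: cylinder_def)

lemma mem_cylinder_iff: "X \<in> cylinder \<sigma> \<longleftrightarrow> (\<forall>i<length \<sigma>. X i = \<sigma> ! i)"
proof -
  have "init_seg X (length \<sigma>) = \<sigma> \<longleftrightarrow> (\<forall>i<length \<sigma>. init_seg X (length \<sigma>) ! i = \<sigma> ! i)"
    by (subst list_eq_iff_nth_eq) simp
  then show ?thesis by (simp add: cylinder_def init_seg_def)
qed

lemma cylinder_split: "cylinder \<sigma> = cylinder (\<sigma> @ [False]) \<union> cylinder (\<sigma> @ [True])"
  by (auto simp: cylinder_def init_seg_Suc)

lemma cylinder_in_borel: "cylinder \<sigma> \<in> sets borel"
proof -
  have "closed {X. X i = b}" for i and b :: bool
    by (intro closed_Collect_eq continuous_on_product_coordinates continuous_on_const)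
  then have "closed (\<Inter>i<length \<sigma>. {X. X i = \<sigma> ! i})"
    by (intro closed_INT) auto
  moreover have "cylinder \<sigma> = (\<Inter>i<length \<sigma>. {X. X i = \<sigma> ! i})"
    by (auto simp: mem_cylinder_iff)
  ultimately show ?thesis by simp
qed

lemma strings_of_length_finite: "finite {\<sigma> :: bool list. length \<sigma> = n}"
  using finite_lists_length_eq[of "UNIV :: bool set" n] by simp

lemma prefix_set_in_borel: "{X. init_seg X n \<in> A} \<in> sets borel"
proof -
  have "{X. init_seg X n \<in> A} = (\<Union>\<sigma>\<in>{\<sigma>. length \<sigma> = n} \<inter> A. cylinder \<sigma>)"
    by (auto simp: cylinder_def)
  then show ?thesis
    using cylinder_in_borel strings_of_length_finite by auto
qed

text \<open>Let \<open>H l\<close> be the set of sequences whose initial segment of length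
  \<open>l\<close> has measure at least \<open>2 ^ (-n)\<close>. These sets decrease, and a sequence in all of them would be
  an atom of \<open>\<mu>\<close>, so their measures tend to 0. A single string of length \<open>l\<close> of measure at least
  \<open>2 ^ (-n)\<close> would already give \<open>H l\<close> that much measure, so for large \<open>l\<close> there is none.
  Continuity from above takes the place of a compactness argument.\<close>

lemma granularity_attained:
  assumes "cantor_measure \<mu>" "continuous_measure \<mu>" "length \<sigma> = granularity \<mu> n"
  shows "measure \<mu> (cylinder \<sigma>) < (1 / 2) ^ n"
proof -
  interpret prob_space \<mu> using assms(1) by (simp add: cantor_measure_def)
  have sets: "sets \<mu> = sets borel" using assms(1) by (simp add: cantor_measure_def)
  have mono: "prob (cylinder (init_seg Y l)) \<le> prob (cylinder (init_seg Y k))" if "k \<le> l" for Y k l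
    using that by (intro finite_measure_mono)
      (auto simp: mem_cylinder_iff init_seg_def sets cylinder_in_borel)
  define H where "H l = {Y. prob (cylinder (init_seg Y l)) \<ge> (1 / 2) ^ n}" for l
  have H_meas: "range H \<subseteq> events"
    using prefix_set_in_borel[where A = "{\<sigma>. prob (cylinder \<sigma>) \<ge> (1 / 2) ^ n}"]
    by (auto simp: H_def sets)
  have "decseq H"
    unfolding decseq_def H_def using mono order_trans by fastforce
  have point: "(\<lambda>l. prob (cylinder (init_seg Y l))) \<longlonglongrightarrow> 0" for Y
  proof -
    have "(\<Inter>l. cylinder (init_seg Y l)) = {Y}"
    proof (intro equalityI subsetI)
      fix Z assume Z: "Z \<in> (\<Inter>l. cylinder (init_seg Y l))"
      have "Z i = Y i" for i
      proof -
        have "Z \<in> cylinder (init_seg Y (Suc i))" using Z by blast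
        then show ?thesis by (simp add: mem_cylinder_iff init_seg_def nth_append)
      qed
      then show "Z \<in> {Y}" by auto
    qed (simp add: mem_cylinder_init_seg)
    moreover have "decseq (\<lambda>l. cylinder (init_seg Y l))"
      by (auto simp: decseq_def mem_cylinder_iff init_seg_def)
    moreover have "range (\<lambda>l. cylinder (init_seg Y l)) \<subseteq> events"
      by (auto simp: sets cylinder_in_borel)
    ultimately show ?thesis
      using finite_Lim_measure_decseq[of "\<lambda>l. cylinder (init_seg Y l)"] assms(2)
      by (simp add: continuous_measure_def)
  qed
  have "Y \<notin> (\<Inter>l. H l)" for Y
  proof
    assume "Y \<in> (\<Inter>l. H l)"
    then have "(1 / 2) ^ n \<le> (0::real)"
      by (intro LIMSEQ_le_const[OF point]) (auto simp: H_def)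
    moreover have "0 < ((1 / 2) ^ n :: real)" by simp
    ultimately show False by linarith
  qed
  then have "(\<Inter>l. H l) = {}" by blast
  then have "(\<lambda>l. prob (H l)) \<longlonglongrightarrow> 0"
    using finite_Lim_measure_decseq[OF H_meas \<open>decseq H\<close>] by simp
  then have "eventually (\<lambda>l. prob (H l) < (1 / 2) ^ n) sequentially"
    by (rule order_tendstoD) simp
  then obtain l where l: "prob (H l) < (1 / 2) ^ n"
    by (auto simp: eventually_sequentially)
  have "prob (cylinder \<tau>) < (1 / 2) ^ n" if "length \<tau> = l" for \<tau>
  proof (rule ccontr)
    assume "\<not> prob (cylinder \<tau>) < (1 / 2) ^ n"
    then have "cylinder \<tau> \<subseteq> H l" using that by (auto simp: H_def cylinder_def)
    then have "prob (cylinder \<tau>) \<le> prob (H l)"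
      using H_meas by (intro finite_measure_mono) auto
    with l \<open>\<not> prob (cylinder \<tau>) < (1 / 2) ^ n\<close> show False by simp
  qed
  then have "\<exists>l. \<forall>\<tau>. length \<tau> = l \<longrightarrow> prob (cylinder \<tau>) < (1 / 2) ^ n" by blast
  from LeastI_ex[OF this] show ?thesis
    unfolding granularity_def[symmetric] using assms(3) by blast
qed

section \<open>The ratio of a semi-measure to a measure along random sequences\<close>

text \<open>The finite-depth maximal inequality, by induction on the depth \<open>k\<close> for all strings at once. If
  \<open>\<sigma>\<close> itself satisfies \<open>\<rho> \<sigma> > a * \<mu> \<sigma>\<close>, the whole cylinder of \<open>\<sigma>\<close> is paid for. Otherwise the
  first string that does lies strictly below \<open>\<sigma>\<close>, and the bounds for the two children add up to at
  most \<open>\<rho> \<sigma>\<close>. Starting from an arbitrary \<open>\<sigma>\<close> instead of the empty string makes the induction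
  work.\<close>

lemma semi_measure_maximal_inequality_below:
  assumes "cantor_measure \<mu>" "semi_measure \<rho>" "0 \<le> a"
  shows "a * measure \<mu> {Y \<in> cylinder \<sigma>. \<exists>n\<le>length \<sigma> + k. length \<sigma> \<le> n \<and>
           \<rho> (init_seg Y n) > a * measure \<mu> (cylinder (init_seg Y n))} \<le> \<rho> \<sigma>"
proof -
  interpret prob_space \<mu> using assms(1) by (simp add: cantor_measure_def)
  have sets: "sets \<mu> = sets borel" using assms(1) by (simp add: cantor_measure_def)
  define S where "S = {\<tau>. \<rho> \<tau> > a * prob (cylinder \<tau>)}"
  define V where "V \<tau> k = {Y \<in> cylinder \<tau>. \<exists>n\<le>length \<tau> + k. length \<tau> \<le> n \<and> init_seg Y n \<in> S}"
    for \<tau> k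
  have V_meas: "V \<tau> k \<in> events" for \<tau> k
  proof -
    have "V \<tau> k = cylinder \<tau> \<inter> (\<Union>n\<in>{length \<tau>..length \<tau> + k}. {Y. init_seg Y n \<in> S})"
      by (auto simp: V_def)
    then show ?thesis
      using cylinder_in_borel prefix_set_in_borel by (auto simp: sets)
  qed
  have "a * prob (V \<sigma> k) \<le> \<rho> \<sigma>"
  proof (induction k arbitrary: \<sigma>)
    case 0
    show ?case
    proof (cases "\<sigma> \<in> S")
      case True
      have "prob (V \<sigma> 0) \<le> prob (cylinder \<sigma>)"
        by (intro finite_measure_mono) (auto simp: V_def sets cylinder_in_borel)
      with True show ?thesis
        using mult_left_mono[OF _ assms(3)] unfolding S_def by fastforce
    next
      case False
      then have "V \<sigma> 0 = {}" by (auto simp: V_def cylinder_def)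
      then show ?thesis using assms(2) by (simp add: semi_measure_def)
    qed
  next
    case (Suc k)
    show ?case
    proof (cases "\<sigma> \<in> S")
      case True
      have "prob (V \<sigma> (Suc k)) \<le> prob (cylinder \<sigma>)"
        by (intro finite_measure_mono) (auto simp: V_def sets cylinder_in_borel)
      with True show ?thesis
        using mult_left_mono[OF _ assms(3)] unfolding S_def by fastforce
    next
      case False
      have "V \<sigma> (Suc k) \<subseteq> V (\<sigma> @ [False]) k \<union> V (\<sigma> @ [True]) k"
      proof
        fix Y assume "Y \<in> V \<sigma> (Suc k)"
        then obtain n where n: "Y \<in> cylinder \<sigma>" "n \<le> length \<sigma> + Suc k" "length \<sigma> \<le> n"
          "init_seg Y n \<in> S" by (auto simp: V_def)
        with False have "n \<noteq> length \<sigma>" by (auto simp: cylinder_def)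
        with n have "Suc (length \<sigma>) \<le> n" "n \<le> Suc (length \<sigma>) + k" by auto
        with n cylinder_split[of \<sigma>] show "Y \<in> V (\<sigma> @ [False]) k \<union> V (\<sigma> @ [True]) k"
          by (auto simp: V_def)
      qed
      then have "prob (V \<sigma> (Suc k)) \<le> prob (V (\<sigma> @ [False]) k \<union> V (\<sigma> @ [True]) k)"
        using V_meas by (intro finite_measure_mono) auto
      also have "\<dots> \<le> prob (V (\<sigma> @ [False]) k) + prob (V (\<sigma> @ [True]) k)"
        using V_meas by (intro measure_Un_le) auto
      finally have "a * prob (V \<sigma> (Suc k)) \<le> a * (prob (V (\<sigma> @ [False]) k) + prob (V (\<sigma> @ [True]) k))"
        using assms(3) by (rule mult_left_mono)
      also have "\<dots> \<le> \<rho> (\<sigma> @ [False]) + \<rho> (\<sigma> @ [True])"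
        using Suc.IH[of "\<sigma> @ [False]"] Suc.IH[of "\<sigma> @ [True]"] by (simp add: distrib_left)
      also have "\<dots> \<le> \<rho> \<sigma>" using assms(2) by (simp add: semi_measure_def)
      finally show ?thesis .
    qed
  qed
  then show ?thesis by (simp add: V_def S_def)
qed

text \<open>At the root \<open>\<rho>\<close> has value 1, so the bound does not depend on the depth and survives the limit.\<close>

lemma semi_measure_maximal_inequality:
  assumes "cantor_measure \<mu>" "semi_measure \<rho>" "0 < a"
  shows "measure \<mu> (\<Union>\<sigma>\<in>{\<sigma>. \<rho> \<sigma> > a * measure \<mu> (cylinder \<sigma>)}. cylinder \<sigma>) \<le> 1 / a"
proof -
  interpret prob_space \<mu> using assms(1) by (simp add: cantor_measure_def)
  have sets: "sets \<mu> = sets borel" using assms(1) by (simp add: cantor_measure_def)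
  define S where "S = {\<tau>. \<rho> \<tau> > a * prob (cylinder \<tau>)}"
  define W where "W k = {Y. \<exists>n\<le>k. init_seg Y n \<in> S}" for k
  have bound: "prob (W k) \<le> 1 / a" for k
  proof -
    have "a * prob (W k) \<le> \<rho> []"
      using semi_measure_maximal_inequality_below[OF assms(1,2), of a "[]" k] assms(3)
      by (simp add: W_def S_def mem_cylinder_iff)
    then show ?thesis
      using assms(2,3) by (simp add: semi_measure_def field_simps)
  qed
  have "W k = (\<Union>n\<in>{..k}. {Y. init_seg Y n \<in> S})" for k
    by (auto simp: W_def)
  then have "range W \<subseteq> events"
    using prefix_set_in_borel by (auto simp: sets)
  moreover have "incseq W"
    unfolding incseq_def W_def using order_trans by fastforce
  ultimately have "(\<lambda>k. prob (W k)) \<longlonglongrightarrow> prob (\<Union>k. W k)"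
    by (rule finite_Lim_measure_incseq)
  then have "prob (\<Union>k. W k) \<le> 1 / a"
    by (rule LIMSEQ_le_const2) (use bound in blast)
  moreover have "(\<Union>k. W k) = (\<Union>\<sigma>\<in>S. cylinder \<sigma>)"
  proof (intro equalityI subsetI)
    fix Y assume "Y \<in> (\<Union>k. W k)"
    then show "Y \<in> (\<Union>\<sigma>\<in>S. cylinder \<sigma>)"
      using mem_cylinder_init_seg by (auto simp: W_def)
  next
    fix Y assume "Y \<in> (\<Union>\<sigma>\<in>S. cylinder \<sigma>)"
    then obtain \<sigma> where "\<sigma> \<in> S" "init_seg Y (length \<sigma>) = \<sigma>"
      by (auto simp: cylinder_def)
    then have "Y \<in> W (length \<sigma>)" by (auto simp: W_def)
    then show "Y \<in> (\<Union>k. W k)" by blast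
  qed
  ultimately show ?thesis by (simp add: S_def)
qed

text \<open>Increasing the approximation \<open>r t\<close> by its error bound makes it an upper bound of \<open>y\<close>, so a success
  at any single stage \<open>t\<close> is conclusive; a strict inequality in the limit shows at some stage.\<close>

lemma exceeds_iff_approximations_exceed:
  fixes q r :: "nat \<Rightarrow> rat" and x y a :: real
  assumes "incseq q" "(\<lambda>t. of_rat (q t)) \<longlonglongrightarrow> x" "\<And>t. \<bar>of_rat (r t) - y\<bar> \<le> (1 / 2) ^ t" "0 \<le> a"
  shows "x > a * y \<longleftrightarrow> (\<exists>t. of_rat (q t) > a * (of_rat (r t) + (1 / 2) ^ t))"
proof
  assume "x > a * y"
  have pow: "(\<lambda>t. (1 / 2) ^ t :: real) \<longlonglongrightarrow> 0" by (rule LIMSEQ_power_zero) simp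
  have "(\<lambda>t. of_rat (r t) - y) \<longlonglongrightarrow> 0"
    by (rule tendsto_0_le[OF pow, of _ 1]) (use assms(3) in auto)
  then have "(\<lambda>t. of_rat (r t)) \<longlonglongrightarrow> y" by (simp add: LIM_zero_iff)
  then have "(\<lambda>t. of_rat (q t) - a * (of_rat (r t) + (1 / 2) ^ t)) \<longlonglongrightarrow> x - a * (y + 0)"
    by (intro tendsto_intros assms(2) pow)
  then have "eventually (\<lambda>t. 0 < of_rat (q t) - a * (of_rat (r t) + (1 / 2) ^ t)) sequentially"
    by (rule order_tendstoD) (use \<open>x > a * y\<close> in simp)
  then obtain t where "0 < of_rat (q t) - a * (of_rat (r t) + (1 / 2) ^ t)"
    by (auto simp: eventually_sequentially)
  then show "\<exists>t. of_rat (q t) > a * (of_rat (r t) + (1 / 2) ^ t)" by (intro exI[of _ t]) simp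
next
  assume "\<exists>t. of_rat (q t) > a * (of_rat (r t) + (1 / 2) ^ t)"
  then obtain t where t: "of_rat (q t) > a * (of_rat (r t) + (1 / 2) ^ t)" ..
  have "y \<le> of_rat (r t) + (1 / 2) ^ t" using assms(3)[of t] by (simp add: abs_le_iff)
  then have "a * y \<le> a * (of_rat (r t) + (1 / 2) ^ t)" using assms(4) by (rule mult_left_mono)
  also note t
  also have "of_rat (q t) \<le> x"
    by (rule LIMSEQ_le_const[OF assms(2)]) (use assms(1) in \<open>auto simp: incseq_def of_rat_less_eq\<close>)
  finally show "x > a * y" .
qed

text \<open>Clearing denominators, and moving negative terms to the other side, states the comparison of two
  signed fractions as the vanishing of a natural number computed by additions, multiplications,
  powers of two and one truncated subtraction: \<open>v < u\<close> holds iff \<open>Suc v - u = 0\<close>.\<close>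

lemma fraction_comparison_nat:
  fixes a b d a' b' d' i t :: nat
  shows "2 ^ i * ((real a' - real b') / real (Suc d') + (1 / 2) ^ t) < (real a - real b) / real (Suc d)
     \<longleftrightarrow> Suc (b * Suc d' * 2 ^ t + 2 ^ i * Suc d * (a' * 2 ^ t + Suc d'))
         - (a * Suc d' * 2 ^ t + 2 ^ i * Suc d * (b' * 2 ^ t)) = 0"
    (is "_ \<longleftrightarrow> Suc ?v - ?u = 0")
proof -
  define D D' T where "D = real (Suc d)" and "D' = real (Suc d')" and "T = (2::real) ^ t"
  have pos: "D > 0" "D' > 0" "T > 0" by (auto simp: D_def D'_def T_def)
  have "2 ^ i * ((real a' - real b') / D' + 1 / T) < (real a - real b) / D
    \<longleftrightarrow> 2 ^ i * ((real a' - real b') / D' + 1 / T) * (D * D' * T) < (real a - real b) / D * (D * D' * T)"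
    using pos by (subst mult_less_cancel_right_pos) simp_all
  also have "2 ^ i * ((real a' - real b') / D' + 1 / T) * (D * D' * T)
     = 2 ^ i * D * ((real a' - real b') * T + D')"
    using pos by (simp add: field_simps)
  also have "(real a - real b) / D * (D * D' * T) = (real a - real b) * D' * T"
    using pos by simp
  also have "2 ^ i * D * ((real a' - real b') * T + D') < (real a - real b) * D' * T
     \<longleftrightarrow> real ?v < real ?u"
  proof -
    have "real ?v = real b * D' * T + 2 ^ i * D * (real a' * T + D')"
      "real ?u = real a * D' * T + 2 ^ i * D * (real b' * T)"
      by (simp_all only: of_nat_add of_nat_mult of_nat_power of_nat_numeral D_def D'_def T_def)
    then show ?thesis by (simp only:) (simp add: algebra_simps)
  qed
  also have "real ?v < real ?u \<longleftrightarrow> Suc ?v - ?u = 0"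
    unfolding of_nat_less_iff by (simp only: diff_is_0_eq Suc_le_eq)
  finally show ?thesis
    by (simp only: D_def D'_def T_def power_one_over)
qed

text \<open>The machine for \<open>(i, \<sigma>)\<close> searches for a stage \<open>t\<close> at which the approximations witness
  \<open>\<rho> \<sigma> > 2 ^ i * h \<sigma>\<close>.\<close>

lemma semi_measure_test_sigma01:
  assumes "left_ce \<rho>" "computable_real_fun h"
  shows "uniformly_sigma01 (\<lambda>i. \<Union>\<sigma>\<in>{\<sigma>. \<rho> \<sigma> > 2 ^ i * h \<sigma>}. cylinder \<sigma>)"
proof -
  obtain q where q: "computable_rat 2 q" "\<And>\<sigma>. incseq (\<lambda>t. q [str_code \<sigma>, t])"
    "\<And>\<sigma>. (\<lambda>t. of_rat (q [str_code \<sigma>, t])) \<longlonglongrightarrow> \<rho> \<sigma>"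
    using assms(1) unfolding left_ce_def by blast
  obtain r where r: "computable_rat 2 r"
    "\<And>\<sigma> t. \<bar>of_rat (r [str_code \<sigma>, t]) - h \<sigma>\<bar> \<le> (1 / 2) ^ t"
    using assms(2) unfolding computable_real_fun_def by blast
  obtain a b d where abd: "computable 2 a" "computable 2 b" "computable 2 d"
    and q_eq: "\<And>xs. length xs = 2 \<Longrightarrow> q xs = (of_nat (a xs) - of_nat (b xs)) / of_nat (Suc (d xs))"
    using q(1) unfolding computable_rat_def by blast
  obtain a' b' d' where abd': "computable 2 a'" "computable 2 b'" "computable 2 d'"
    and r_eq: "\<And>xs. length xs = 2 \<Longrightarrow> r xs = (of_nat (a' xs) - of_nat (b' xs)) / of_nat (Suc (d' xs))"
    using r(1) unfolding computable_rat_def by blast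
  \<comment> \<open>The argument list is \<open>[t, i, str_code \<sigma>]\<close>, with the search variable in front; \<open>y\<close> is the
    argument list \<open>[str_code \<sigma>, t]\<close> of the approximations.\<close>
  define f where "f xs = (let t = xs ! 0; i = xs ! 1; y = [xs ! 2, xs ! 0] in
    Suc (b y * Suc (d' y) * 2 ^ t + 2 ^ i * Suc (d y) * (a' y * 2 ^ t + Suc (d' y)))
         - (a y * Suc (d' y) * 2 ^ t + 2 ^ i * Suc (d y) * (b' y * 2 ^ t)))" for xs
  have "computable (Suc 2) f"
    unfolding f_def Let_def by (intro computable_intros abd abd') auto
  from semidecidable_search[OF this] obtain p where
    p: "\<And>xs. length xs = 2 \<Longrightarrow> peval p xs \<noteq> None \<longleftrightarrow> (\<exists>t. f (t # xs) = 0)"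
    by blast
  have "peval p [i, str_code \<sigma>] \<noteq> None \<longleftrightarrow> \<rho> \<sigma> > 2 ^ i * h \<sigma>" for i \<sigma>
  proof -
    have "f [t, i, str_code \<sigma>] = 0 \<longleftrightarrow>
      of_rat (q [str_code \<sigma>, t]) > (2::real) ^ i * (of_rat (r [str_code \<sigma>, t]) + (1 / 2) ^ t)" for t
      unfolding f_def Let_def
      using fraction_comparison_nat[of i "a' [str_code \<sigma>, t]" "b' [str_code \<sigma>, t]"
          "d' [str_code \<sigma>, t]" t "a [str_code \<sigma>, t]" "b [str_code \<sigma>, t]" "d [str_code \<sigma>, t]"]
      by (simp add: q_eq r_eq of_rat_divide of_rat_diff of_rat_add del: of_nat_Suc)
    moreover have "peval p [i, str_code \<sigma>] \<noteq> None \<longleftrightarrow> (\<exists>t. f [t, i, str_code \<sigma>] = 0)"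
      by (rule p) simp
    ultimately show ?thesis
      using exceeds_iff_approximations_exceed[OF q(2)[of \<sigma>] q(3)[of \<sigma>] r(2)[of \<sigma>], of "2 ^ i"]
      by simp
  qed
  then show ?thesis
    unfolding uniformly_sigma01_def by (intro exI[of _ p]) simp
qed

lemma ml_random_imp_ratio_bounded:
  assumes "cantor_measure \<mu>" "computable_measure \<mu>" "semi_measure \<rho>" "left_ce \<rho>" "ml_random \<mu> X"
  shows "\<exists>i. \<forall>n. \<rho> (init_seg X n) \<le> 2 ^ i * measure \<mu> (cylinder (init_seg X n))"
proof -
  define U where "U i = (\<Union>\<sigma>\<in>{\<sigma>. \<rho> \<sigma> > 2 ^ i * measure \<mu> (cylinder \<sigma>)}. cylinder \<sigma>)" for i :: nat
  have "uniformly_sigma01 U"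
    unfolding U_def using semi_measure_test_sigma01[OF assms(4)] assms(2)
    by (simp add: computable_measure_def)
  moreover have "measure \<mu> (U i) \<le> (1 / 2) ^ i" for i
    using semi_measure_maximal_inequality[OF assms(1,3), of "2 ^ i"]
    by (simp add: U_def power_one_over)
  ultimately obtain i where "X \<notin> U i"
    using assms(5) unfolding ml_random_def ml_test_def by blast
  then have "\<rho> (init_seg X n) \<le> 2 ^ i * measure \<mu> (cylinder (init_seg X n))" for n
    using mem_cylinder_init_seg[of X n] by (force simp: U_def not_less)
  then show ?thesis by blast
qed

section \<open>Positivity of the universal semi-measure and monotonicity\<close>

lemma str_code_inject: "str_code \<sigma> = str_code \<tau> \<longleftrightarrow> \<sigma> = \<tau>"
proof -
  have "inj (of_bool :: bool \<Rightarrow> nat)" by (rule injI) (simp add: of_bool_eq_iff)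
  then show ?thesis by (simp add: str_code_def list_encode_eq)
qed

text \<open>Universality is applied to the semi-measure that is 1 on \<open>\<tau>\<close> and its prefixes and 0 elsewhere. It has
  finite support, so it is computable and its approximations can be constant in time.\<close>

lemma universal_semi_measure_pos:
  assumes "universal_left_ce_semi_measure M"
  shows "M \<tau> > 0"
proof -
  define \<rho> :: "bool list \<Rightarrow> real" where "\<rho> \<sigma> = of_bool (prefix \<sigma> \<tau>)" for \<sigma>
  have not_both: "\<not> (prefix (\<sigma> @ [False]) \<tau> \<and> prefix (\<sigma> @ [True]) \<tau>)" for \<sigma>
    by (auto simp: prefix_def)
  have "semi_measure \<rho>"
    unfolding semi_measure_def \<rho>_def using not_both append_prefixD by (auto simp: of_bool_def)
  moreover have "left_ce \<rho>"
  proof -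
    define A where "A = str_code ` {\<sigma>. prefix \<sigma> \<tau>}"
    have "finite {\<sigma>. prefix \<sigma> \<tau>}"
      using finite_set[of "prefixes \<tau>"] by (simp add: set_prefixes_eq)
    then have "finite A" by (simp add: A_def)
    then have "computable 2 (\<lambda>xs. of_bool (xs ! 0 \<in> A))"
      by (rule computable_finite_indicator) simp
    then have "computable_rat 2 (\<lambda>xs. of_bool (xs ! 0 \<in> A))"
      unfolding computable_rat_def
      by (intro exI[of _ "\<lambda>xs. of_bool (xs ! 0 \<in> A)"] exI[of _ "\<lambda>_. 0"])
        (simp add: computable_const)
    moreover have "str_code \<sigma> \<in> A \<longleftrightarrow> prefix \<sigma> \<tau>" for \<sigma>
      by (auto simp: A_def str_code_inject)
    ultimately show ?thesis
      unfolding left_ce_def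
      by (intro exI[of _ "\<lambda>xs. of_bool (xs ! 0 \<in> A)"]) (simp add: \<rho>_def incseq_def)
  qed
  ultimately obtain c where "\<rho> \<tau> \<le> c * M \<tau>"
    using assms unfolding universal_left_ce_semi_measure_def by blast
  then have "M \<tau> \<noteq> 0" by (auto simp: \<rho>_def)
  moreover have "0 \<le> M \<tau>"
    using assms by (simp add: universal_left_ce_semi_measure_def semi_measure_def)
  ultimately show ?thesis by simp
qed

lemma semi_measure_init_seg_antimono:
  assumes "semi_measure \<rho>"
  shows "m \<le> n \<Longrightarrow> \<rho> (init_seg X n) \<le> \<rho> (init_seg X m)"
proof (induction rule: dec_induct)
  case (step n)
  have "\<rho> (\<sigma> @ [b]) \<le> \<rho> \<sigma>" for \<sigma> b
  proof -
    have "0 \<le> \<rho> (\<sigma> @ [\<not> b])" "\<rho> (\<sigma> @ [False]) + \<rho> (\<sigma> @ [True]) \<le> \<rho> \<sigma>"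
      using assms unfolding semi_measure_def by auto
    then show ?thesis by (cases b) auto
  qed
  with step show ?case by (metis init_seg_Suc order_trans)
qed simp

section \<open>Lower bounds for the a priori complexity of random sequences\<close>

theorem proposition3p18:
  fixes \<mu> :: "(nat \<Rightarrow> bool) measure"
    and M :: "bool list \<Rightarrow> real"
    and X :: "nat \<Rightarrow> bool"
  assumes "universal_left_ce_semi_measure M"
    and "cantor_measure \<mu>"
    and "computable_measure \<mu>"
    and "continuous_measure \<mu>"
    and "ml_random \<mu> X"
  shows "\<exists>c::nat. (\<forall>n. KA M (init_seg X (granularity \<mu> n)) \<ge> real n - real c)
                \<and> (\<forall>n. KA M (init_seg X n) \<ge> real (granularity_inv \<mu> n) - real c)"
proof -
  have M: "semi_measure M" "left_ce M"
    using assms(1) by (auto simp: universal_left_ce_semi_measure_def)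
  note pos = universal_semi_measure_pos[OF assms(1)]
  obtain i where i: "\<And>n. M (init_seg X n) \<le> 2 ^ i * measure \<mu> (cylinder (init_seg X n))"
    using ml_random_imp_ratio_bounded[OF assms(2,3) M assms(5)] by blast
  \<comment> \<open>The bounds along the granularity hold with constant \<open>i\<close>; one more is spent below on the
    minimality of \<open>granularity_inv \<mu> n\<close>, so \<open>Suc i\<close> serves both parts.\<close>
  have first: "KA M (init_seg X (granularity \<mu> n)) \<ge> real n - real i" for n
  proof -
    let ?\<sigma> = "init_seg X (granularity \<mu> n)"
    have "measure \<mu> (cylinder ?\<sigma>) < (1 / 2) ^ n"
      using granularity_attained[OF assms(2,4)] by simp
    then have "2 ^ i * measure \<mu> (cylinder ?\<sigma>) \<le> 2 ^ i * (1 / 2) ^ n" by simp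
    also have "\<dots> = 2 powr (real i - real n)"
      by (simp add: powr_diff powr_realpow power_one_over)
    finally have "M ?\<sigma> \<le> 2 powr (real i - real n)" using i order_trans by blast
    then have "log 2 (M ?\<sigma>) \<le> log 2 (2 powr (real i - real n))"
      using pos[of ?\<sigma>] by (subst log_le_cancel_iff) auto
    then show ?thesis by (simp add: KA_def)
  qed
  have "KA M (init_seg X n) \<ge> real (granularity_inv \<mu> n) - real (Suc i)" for n
  proof (cases "granularity_inv \<mu> n")
    case 0
    have "M (init_seg X n) \<le> 1" using M(1) by (simp add: semi_measure_def)
    then have "KA M (init_seg X n) \<ge> 0" using pos by (simp add: KA_def)
    with 0 show ?thesis by simp
  next
    case (Suc k)
    then have "k < (LEAST k. granularity \<mu> k \<ge> n)" by (simp add: granularity_inv_def)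
    from not_less_Least[OF this] have "granularity \<mu> k \<le> n" by simp
    then have "KA M (init_seg X (granularity \<mu> k)) \<le> KA M (init_seg X n)"
      using semi_measure_init_seg_antimono[OF M(1)] pos by (simp add: KA_def)
    with first[of k] Suc show ?thesis by simp
  qed
  moreover have "KA M (init_seg X (granularity \<mu> n)) \<ge> real n - real (Suc i)" for n
    using first[of n] by simp
  ultimately show ?thesis by blast
qed

end
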